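(* For $1\le r\le n$, the average height of the $r$th up-step over all paths in $\mathcal D_n$ equals $$\frac{(2r+1)(2(n-r)+1)}{n+2}\cdot\frac{\binom{2r}{r}\binom{2(n-r)}{n-r}}{\binom{2n}{n}}+\frac{3(r+1)}{n+2}-2.$$ As $n\to\infty$, this average is asymptotically equal to $$\begin{cases} \displaystyle\frac{4r+2}{4^{r}}\binom{2r}{r}-2 & \text{if $r$ is fixed},\\[2mm] \displaystyle\frac{4s+2}{4^{s}}\binom{2s}{s}+1 & \text{if $s=n-r$ is fixed},\\[2mm] \displaystyle\frac{4}{\sqrt{\pi}}\sqrt{r\left(1-\frac{r}{n}\right)} & \text{if $r=r(n)$ is such that $r\to\infty$ and $n-r\to\infty$}. \end{cases}$$
   Context: A Dyck path of semilength $n$ is a lattice path in $\mathbb Z^2$ with up-steps $(1,1)$ and down-steps $(1,-1)$ that starts at $(0,0)$, ends at $(2n,0)$, and never goes below the $x$-axis; $\mathcal D_n$ is the set of these. The height of a step is the $y$-coordinate of its highest point. The up-steps of a path in $\mathcal D_n$ are indexed $1,\dots,n$ from left to right. The average is over the uniform distribution on $\mathcal D_n$. For fixed $r$ (or fixed $s$), "asymptotically equal" means that the average converges to the displayed constant; when $r=r(n)$ varies as in the last case, it means that the ratio of the two quantities tends to $1$. *)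

theory Defs
  imports "HOL-Probability.Probability" "HOL-Library.Landau_Symbols" "HOL-Library.Product_Plus"
begin

text \<open>A lattice path starting at the origin is encoded by the list of its steps.\<close>

datatype step = Up | Down

fun step_vector :: "step \<Rightarrow> int \<times> int" where
  "step_vector Up = (1, 1)"
| "step_vector Down = (1, -1)"

definition point_at :: "step list \<Rightarrow> nat \<Rightarrow> int \<times> int" where
  "point_at p k = sum_list (map step_vector (take k p))"

text \<open>The path is piecewise linear, so it stays weakly above the x-axis iff its vertices do.\<close>

definition dyck_paths :: "nat \<Rightarrow> step list set" where
  "dyck_paths n = {p. point_at p (length p) = (2 * int n, 0) \<and>
                      (\<forall>k \<le> length p. 0 \<le> snd (point_at p k))}"

text \<open>The \<open>i\<close>-th entry of \<open>p\<close> (counted from 0) joins \<open>point_at p i\<close> to \<open>point_at p (Suc i)\<close>.\<close>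

definition step_height :: "step list \<Rightarrow> nat \<Rightarrow> int" where
  "step_height p i = max (snd (point_at p i)) (snd (point_at p (Suc i)))"

text \<open>List position (from 0) of the \<open>r\<close>-th up-step (\<open>r\<close> counted from 1).  Only meaningful
  when \<open>1 \<le> r\<close> and \<open>p\<close> has at least \<open>r\<close> up-steps.\<close>

definition up_step_position :: "step list \<Rightarrow> nat \<Rightarrow> nat" where
  "up_step_position p r = filter (\<lambda>i. p ! i = Up) [0..<length p] ! (r - 1)"

definition up_step_height :: "step list \<Rightarrow> nat \<Rightarrow> int" where
  "up_step_height p r = step_height p (up_step_position p r)"

definition average_up_step_height :: "nat \<Rightarrow> nat \<Rightarrow> real" where
  "average_up_step_height n r =
     measure_pmf.expectation (pmf_of_set (dyck_paths n)) (\<lambda>p. real_of_int (up_step_height p r))"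

end

theory Submission
  imports Defs "HOL-Real_Asymp.Real_Asymp"
begin

text \<open>
  Call a Dyck path with a distinguished vertex a marked Dyck path, and let \<open>V n i\<close> be the
  number of those of semilength \<open>n\<close> with exactly \<open>i\<close> up-steps before the mark.  The \<open>r\<close>-th
  up-step of a path is at position \<open>k\<close> of the word when it is preceded by \<open>r - 1\<close> up-steps and
  \<open>k - (r - 1)\<close> down-steps, so its height is \<open>2 * r - (k + 1)\<close>, and \<open>k + 1\<close> is the number of
  vertices that have fewer than \<open>r\<close> up-steps before them.  Summing over all paths gives
  \<open>2 * r * c n - (\<Sum>i<r. V n i)\<close>, where \<open>c n\<close> is the number of Dyck paths
  (\<open>up_step_height_eq\<close>, \<open>sum_card_marked\<close>).

  To count marks, look at the step before the marked vertex.  If it is an up-step, it is the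
  \<open>i\<close>-th one, and every path has exactly one such vertex; for \<open>i = 0\<close> the starting vertex takes
  its place.  If it is a down-step, that step closes
  a factor \<open>Up B Down\<close> with \<open>B\<close> a Dyck path, and deleting this factor leaves a smaller marked
  path.  Hence
  \<open>V n i = c n + (\<Sum>j<i. c j * V (n - j - 1) (i - j - 1))\<close> (\<open>card_marked_rec\<close>), and the
  Catalan recurrence turns this into \<open>V n i = (\<Sum>k\<le>i. c k * c (n - k))\<close>
  (\<open>card_marked_dyck_paths\<close>).

  These partial convolutions of the Catalan numbers have a closed form
  (\<open>catalan_partial_convolution\<close>), whose complete case is the Catalan recurrence itself, and their
  sum over \<open>i < r\<close> has a closed form as well (\<open>catalan_double_sum\<close>).  Dividing by \<open>c n\<close> gives
  the exact average.

  For the asymptotics, the average is rewritten with \<open>w n = binomial (2 n) n / 4 ^ n\<close>, for which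
  \<open>w n \<sim> 1 / sqrt (pi * n)\<close>; the powers of \<open>4\<close> cancel because \<open>r + (n - r) = n\<close>.  With \<open>r\<close> or
  \<open>n - r\<close> fixed, every factor converges.  When both tend to infinity, the term with the central
  binomials grows like \<open>4 * sqrt (r * (n - r) / (pi * n))\<close>, and the remaining terms are bounded.
\<close>

section \<open>Dyck paths as words\<close>

definition end_height :: "step list \<Rightarrow> int" where
  "end_height p = snd (sum_list (map step_vector p))"

abbreviation ups :: "step list \<Rightarrow> nat" where
  "ups p \<equiv> count_list p Up"

text \<open>The starting height is a parameter so that the condition splits along concatenations
  (\<open>stays_nonneg_append\<close>): the second factor starts where the first one ends.\<close>
fun stays_nonneg :: "int \<Rightarrow> step list \<Rightarrow> bool" where
  "stays_nonneg h [] \<longleftrightarrow> 0 \<le> h"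
| "stays_nonneg h (Up # p) \<longleftrightarrow> 0 \<le> h \<and> stays_nonneg (h + 1) p"
| "stays_nonneg h (Down # p) \<longleftrightarrow> 0 \<le> h \<and> stays_nonneg (h - 1) p"

lemma end_height_simps [simp]:
  "end_height [] = 0" "end_height (Up # p) = end_height p + 1" "end_height (Down # p) = end_height p - 1"
  "end_height (p @ q) = end_height p + end_height q"
  by (simp_all add: end_height_def)

lemma end_height_eq: "end_height p = 2 * int (ups p) - int (length p)"
proof (induction p)
  case (Cons x p) then show ?case by (cases x) auto
qed simp

lemma stays_nonneg_start: "stays_nonneg h p \<Longrightarrow> 0 \<le> h"
  by (cases "(h, p)" rule: stays_nonneg.cases) auto

lemma stays_nonneg_append [simp]:
  "stays_nonneg h (p @ q) \<longleftrightarrow> stays_nonneg h p \<and> stays_nonneg (h + end_height p) q"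
  by (induction h p rule: stays_nonneg.induct)
     (auto simp: algebra_simps dest: stays_nonneg_start)

lemma stays_nonneg_mono: "stays_nonneg h p \<Longrightarrow> h \<le> h' \<Longrightarrow> stays_nonneg h' p"
  by (induction h p arbitrary: h' rule: stays_nonneg.induct) auto

lemma stays_nonneg_end: "stays_nonneg h p \<Longrightarrow> 0 \<le> h + end_height p"
  by (induction h p rule: stays_nonneg.induct) (auto simp: algebra_simps)

lemma stays_nonneg_iff_take:
  "stays_nonneg h p \<longleftrightarrow> (\<forall>k\<le>length p. 0 \<le> h + end_height (take k p))"
proof -
  have all_le_Suc: "(\<forall>k\<le>Suc n. P k) \<longleftrightarrow> P 0 \<and> (\<forall>k\<le>n. P (Suc k))" for P and n :: nat
    using not0_implies_Suc by (metis Suc_le_mono le0)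
  show ?thesis
    by (induction h p rule: stays_nonneg.induct) (simp_all add: all_le_Suc algebra_simps)
qed

lemma snd_point_at: "snd (point_at p k) = end_height (take k p)"
  by (simp add: point_at_def end_height_def)

lemma fst_point_at: "fst (point_at p k) = int (length (take k p))"
proof -
  have "fst (sum_list (map step_vector q)) = int (length q)" for q
  proof (induction q)
    case (Cons x q) then show ?case by (cases x) auto
  qed simp
  then show ?thesis by (simp add: point_at_def)
qed

lemma mem_dyck_paths_iff:
  "p \<in> dyck_paths n \<longleftrightarrow> stays_nonneg 0 p \<and> end_height p = 0 \<and> ups p = n"
  using end_height_eq[of p]
  by (auto simp: dyck_paths_def stays_nonneg_iff_take snd_point_at fst_point_at prod_eq_iff)

lemma finite_dyck_paths [simp]: "finite (dyck_paths n)"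
proof (rule finite_subset)
  have "finite (UNIV :: step set)"
    by (rule finite_subset[of _ "{Up, Down}"]) (use step.exhaust in auto)
  then show "finite {p :: step list. set p \<subseteq> UNIV \<and> length p = 2 * n}"
    by (rule finite_lists_length_eq)
  show "dyck_paths n \<subseteq> {p. set p \<subseteq> UNIV \<and> length p = 2 * n}"
    using end_height_eq by (fastforce simp: mem_dyck_paths_iff)
qed

text \<open>The inserted factor is a Dyck path raised by one level, so it neither dips below its
  starting height nor changes the heights of the vertices around it.\<close>
lemma insert_dyck_path:
  assumes "B \<in> dyck_paths j"
  shows "a @ Up # B @ Down # b \<in> dyck_paths n
     \<longleftrightarrow> Suc j \<le> n \<and> a @ b \<in> dyck_paths (n - Suc j)"
  using assms stays_nonneg_mono[of 0 B "end_height a + 1"] stays_nonneg_end[of 0 a]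
  by (auto simp: mem_dyck_paths_iff algebra_simps dest: stays_nonneg_start)

text \<open>The up-step that leaves height \<open>end_height q - 1\<close> for the last time: what follows it
  returns to its level without going below.  If \<open>q\<close> ends with a down-step, the word before that
  step is two levels above the target, so two such up-steps are peeled off; the one peeled off first
  is matched by the final down-step.\<close>
lemma last_up_below:
  assumes "stays_nonneg 0 q" "1 \<le> end_height q"
  shows "\<exists>a B. q = a @ Up # B \<and> stays_nonneg 0 B \<and> end_height B = 0"
  using assms
proof (induction "length q" arbitrary: q rule: less_induct)
  case less
  from less.prems have "q \<noteq> []" by auto
  then obtain q' x where q: "q = q' @ [x]" by (metis rev_exhaust)
  show ?case
  proof (cases x)
    case Up then show ?thesis using q by (intro exI[of _ q'] exI[of _ "[]"]) auto
  next
    case Down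
    have "stays_nonneg 0 q'" "1 \<le> end_height q'" using less.prems by (auto simp: q Down)
    then obtain a1 B1 where 1: "q' = a1 @ Up # B1" "stays_nonneg 0 B1" "end_height B1 = 0"
      using less.hyps[of q'] by (auto simp: q)
    have "stays_nonneg 0 a1" "1 \<le> end_height a1"
      using less.prems by (auto simp: q Down 1)
    then obtain a2 B2 where 2: "a1 = a2 @ Up # B2" "stays_nonneg 0 B2" "end_height B2 = 0"
      using less.hyps[of a1] by (auto simp: q 1)
    have "q = a2 @ Up # (B2 @ Up # B1 @ [Down])" by (simp add: q Down 1 2)
    moreover have "stays_nonneg 1 B1" using 1 stays_nonneg_mono by fastforce
    ultimately show ?thesis using 1 2
      by (intro exI[of _ a2] exI[of _ "B2 @ Up # B1 @ [Down]"]) auto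
  qed
qed

text \<open>If the two factorizations had different up-steps, the word \<open>w\<close> between them would end one
  level below its start, yet it would be a prefix of one of the Dyck paths \<open>B\<close> and \<open>B'\<close>.\<close>
lemma last_up_below_unique:
  assumes "a @ Up # B = a' @ Up # B'"
    and "stays_nonneg 0 B" "end_height B = 0" "stays_nonneg 0 B'" "end_height B' = 0"
  shows "a = a' \<and> B = B'"
proof -
  have differ: False
    if "a' = a @ Up # w" "B = w @ Up # B'" "stays_nonneg 0 B" "end_height B = 0" "end_height B' = 0"
    for a a' w B B' :: "step list"
    using that stays_nonneg_end[of 0 w] by auto
  from assms(1) consider "a = a'" "B = B'"
    | w where "a' = a @ Up # w" "B = w @ Up # B'"
    | w where "a = a' @ Up # w" "B' = w @ Up # B"
    by (auto simp: append_eq_append_conv2 append_eq_Cons_conv Cons_eq_append_conv)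
  then show ?thesis
    using differ assms(2-) by cases blast+
qed

section \<open>Marked Dyck paths\<close>

definition marked_dyck_paths :: "nat \<Rightarrow> nat \<Rightarrow> (step list \<times> step list) set" where
  "marked_dyck_paths n r = {(a, b). a @ b \<in> dyck_paths n \<and> ups a = r}"

lemma finite_marked_dyck_paths [simp]: "finite (marked_dyck_paths n r)"
proof (rule finite_subset)
  show "marked_dyck_paths n r \<subseteq>
     (\<lambda>(p, k). (take k p, drop k p)) ` (SIGMA p : dyck_paths n. {..length p})"
  proof
    fix y assume "y \<in> marked_dyck_paths n r"
    then obtain a b where "y = (a, b)" "a @ b \<in> dyck_paths n"
      by (auto simp: marked_dyck_paths_def)
    then show "y \<in> (\<lambda>(p, k). (take k p, drop k p)) ` (SIGMA p : dyck_paths n. {..length p})"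
      by (intro image_eqI[of _ _ "(a @ b, length a)"]) auto
  qed
qed auto

lemma split_at_up:
  assumes "r < ups p"
  obtains a b where "p = a @ Up # b" "ups a = r"
  using assms
proof (induction p arbitrary: r thesis)
  case (Cons x p)
  show ?case
  proof (cases "x = Up \<and> r = 0")
    case True then show ?thesis using Cons.prems(1)[of "[]" p] by auto
  next
    case False
    have "r - (if x = Up then 1 else 0) < ups p" using Cons.prems(2) False by auto
    then obtain a b where "p = a @ Up # b" "ups a = r - (if x = Up then 1 else 0)"
      using Cons.IH by metis
    then show ?thesis using Cons.prems(1)[of "x # a" b] False by auto
  qed
qed simp

lemma split_at_up_unique:
  assumes "a @ Up # b = a' @ Up # b'" "ups a = ups a'"
  shows "a = a' \<and> b = b'"
  using assms by (auto simp: append_eq_append_conv2 append_eq_Cons_conv Cons_eq_append_conv)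

text \<open>Each path has exactly one vertex directly after its \<open>Suc r\<close>-th up-step.\<close>
lemma card_marked_after_up:
  assumes "r < n"
  shows "card {(a, b) \<in> marked_dyck_paths n (Suc r). a \<noteq> [] \<and> last a = Up} = card (dyck_paths n)"
proof -
  have "bij_betw (\<lambda>(a, b). a @ b)
     {(a, b) \<in> marked_dyck_paths n (Suc r). a \<noteq> [] \<and> last a = Up} (dyck_paths n)"
  proof (rule bij_betw_imageI)
    show "inj_on (\<lambda>(a, b). a @ b) {(a, b) \<in> marked_dyck_paths n (Suc r). a \<noteq> [] \<and> last a = Up}"
    proof (clarsimp simp: inj_on_def marked_dyck_paths_def)
      fix a b a' b'
      assume *: "ups a = Suc r" "a \<noteq> []" "last a = Up" "a @ b = a' @ b'"
        "ups a' = Suc r" "a' \<noteq> []" "last a' = Up"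
      obtain c c' where c: "a = c @ [Up]" "a' = c' @ [Up]"
        using * by (metis append_butlast_last_id)
      show "a = a' \<and> b = b'"
        using * split_at_up_unique[of c b c' b'] by (simp add: c)
    qed
    show "(\<lambda>(a, b). a @ b) ` {(a, b) \<in> marked_dyck_paths n (Suc r). a \<noteq> [] \<and> last a = Up}
        = dyck_paths n"
    proof (intro equalityI subsetI)
      fix p assume p: "p \<in> dyck_paths n"
      then obtain a b where "p = a @ Up # b" "ups a = r"
        using split_at_up[of r p] assms by (auto simp: mem_dyck_paths_iff)
      then show "p \<in> (\<lambda>(a, b). a @ b) ` {(a, b) \<in> marked_dyck_paths n (Suc r). a \<noteq> [] \<and> last a = Up}"
        using p by (intro image_eqI[of _ _ "(a @ [Up], b)"]) (auto simp: marked_dyck_paths_def)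
    qed (auto simp: marked_dyck_paths_def)
  qed
  then show ?thesis by (rule bij_betw_same_card)
qed

text \<open>A marked down-step is removed together with its matching up-step and the Dyck path \<open>B\<close>
  between them; the mark stays where the factor was.  The guard \<open>j < n\<close> excludes the cases
  in which \<open>n - Suc j\<close> is truncated.\<close>
lemma bij_betw_matched_down:
  fixes n r :: nat
  shows "bij_betw (\<lambda>(j, B, a, b). (a @ Up # B @ [Down], b))
    (SIGMA j : {..<r}. if j < n then dyck_paths j \<times> marked_dyck_paths (n - Suc j) (r - Suc j) else {})
    {(a, b) \<in> marked_dyck_paths n r. a \<noteq> [] \<and> last a = Down}"
    (is "bij_betw ?f ?A ?B")
proof (rule bij_betw_imageI)
  show "inj_on ?f ?A"
  proof (rule inj_onI)
    fix x x' assume "x \<in> ?A" "x' \<in> ?A" and eq: "?f x = ?f x'"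
    then obtain j B a b j' B' a' b' where x: "x = (j, B, a, b)" "x' = (j', B', a', b')"
        "B \<in> dyck_paths j" "B' \<in> dyck_paths j'"
      by (auto split: if_splits)
    with eq have "a = a' \<and> B = B'" "b = b'"
      using last_up_below_unique[of a B a' B'] by (auto simp: mem_dyck_paths_iff)
    with x show "x = x'" by (auto simp: mem_dyck_paths_iff)
  qed
  show "?f ` ?A = ?B"
  proof (intro equalityI subsetI)
    fix y assume "y \<in> ?f ` ?A"
    then obtain j B a b where y: "y = (a @ Up # B @ [Down], b)" "j < r" "j < n"
        "B \<in> dyck_paths j" "a @ b \<in> dyck_paths (n - Suc j)" "ups a = r - Suc j"
      by (auto simp: marked_dyck_paths_def split: if_splits)
    have "ups B = j" using y by (auto simp: mem_dyck_paths_iff)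
    then show "y \<in> ?B"
      using y insert_dyck_path[of B j a b n] by (auto simp: marked_dyck_paths_def)
  next
    fix y assume "y \<in> ?B"
    then obtain q b where y: "y = (q @ [Down], b)" "(q @ [Down]) @ b \<in> dyck_paths n" "ups q = r"
      by (cases y; cases "fst y" rule: rev_cases) (auto simp: marked_dyck_paths_def)
    have "stays_nonneg 0 q" "1 \<le> end_height q"
      using y(2) stays_nonneg_start[of "end_height q - 1" b] by (auto simp: mem_dyck_paths_iff)
    then obtain a B where q: "q = a @ Up # B" "stays_nonneg 0 B" "end_height B = 0"
      using last_up_below by blast
    then have B: "B \<in> dyck_paths (ups B)" by (simp add: mem_dyck_paths_iff)
    show "y \<in> ?f ` ?A"
      using y insert_dyck_path[OF B, of a b n] B
      by (intro image_eqI[of _ _ "(ups B, B, a, b)"]) (auto simp: q marked_dyck_paths_def)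
  qed
qed

text \<open>The sum counts the marks that follow a down-step.  The first term counts those that follow
  an up-step if \<open>r\<close> is positive.  If \<open>r = 0\<close> only the starting vertex can be marked, because
  a nonempty Dyck path begins with an up-step.\<close>
lemma card_marked_rec:
  assumes "r \<le> n"
  shows "card (marked_dyck_paths n r) = card (dyck_paths n)
    + (\<Sum>j<r. card (dyck_paths j) * card (marked_dyck_paths (n - Suc j) (r - Suc j)))"
proof (cases r)
  case 0
  have "marked_dyck_paths n 0 = Pair [] ` dyck_paths n"
  proof (intro equalityI subsetI)
    fix y assume "y \<in> marked_dyck_paths n 0"
    then obtain a b where y: "y = (a, b)" "a @ b \<in> dyck_paths n" "ups a = 0"
      by (auto simp: marked_dyck_paths_def)
    have "a = []"
    proof (cases a)
      case (Cons x a')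
      then have "x = Down" using y(3) by (cases x) auto
      then show ?thesis using y(2) Cons stays_nonneg_start[of "-1"]
        by (auto simp: mem_dyck_paths_iff dest: stays_nonneg_start)
    qed
    with y show "y \<in> Pair [] ` dyck_paths n" by auto
  qed (auto simp: marked_dyck_paths_def)
  then show ?thesis by (simp add: 0 card_image inj_on_def)
next
  case (Suc r')
  let ?U = "{(a, b) \<in> marked_dyck_paths n r. a \<noteq> [] \<and> last a = Up}"
  let ?D = "{(a, b) \<in> marked_dyck_paths n r. a \<noteq> [] \<and> last a = Down}"
  have split: "marked_dyck_paths n r = ?U \<union> ?D"
  proof -
    have "last a = Up \<or> last a = Down" for a :: "step list"
      by (cases "last a") auto
    moreover have "a \<noteq> []" if "(a, b) \<in> marked_dyck_paths n r" for a b
      using that by (auto simp: marked_dyck_paths_def Suc)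
    ultimately show ?thesis by blast
  qed
  have fin: "finite ?U" "finite ?D"
    by (auto intro: finite_subset[OF _ finite_marked_dyck_paths[of n r]])
  have "card ?D = card (SIGMA j : {..<r}. if j < n then dyck_paths j \<times> marked_dyck_paths (n - Suc j) (r - Suc j) else {})"
    using bij_betw_same_card[OF bij_betw_matched_down] by simp
  also have "\<dots> = (\<Sum>j<r. card (dyck_paths j) * card (marked_dyck_paths (n - Suc j) (r - Suc j)))"
    using assms by (subst card_SigmaI) (auto intro!: sum.cong simp: card_cartesian_product)
  finally have D: "card ?D = \<dots>" .
  have "card (?U \<union> ?D) = card ?U + card ?D"
    by (rule card_Un_disjoint) (use fin in auto)
  also have "card ?U = card (dyck_paths n)"
    using card_marked_after_up[of r' n] assms unfolding Suc by simp
  finally show ?thesis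
    unfolding D split[symmetric] .
qed

section \<open>Heights of up-steps from marked vertices\<close>

text \<open>With this, the position of an up-step is read off from a factorization of the word, without
  reference to the list of all up-step positions.\<close>
lemma up_step_position_append:
  "up_step_position (a @ Up # b) (Suc (ups a)) = length a"
proof -
  let ?p = "a @ Up # b"
  have upt: "[0..<length ?p] = [0..<length a] @ length a # [Suc (length a)..<length ?p]"
    using upt_add_eq_append[of 0 "length a" "Suc (length b)"] upt_conv_Cons[of "length a" "length ?p"]
    by (simp del: upt_Suc)
  have "length (filter (\<lambda>i. ?p ! i = Up) [0..<length a]) = length (filter (\<lambda>i. a ! i = Up) [0..<length a])"
    by (rule arg_cong[of _ _ length], rule filter_cong) (auto simp: nth_append)
  also have "\<dots> = length (filter (\<lambda>x. x = Up) (map ((!) a) [0..<length a]))"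
    by (simp add: filter_map o_def)
  also have "\<dots> = ups a"
    unfolding map_nth by (induction a) auto
  finally show ?thesis
    unfolding up_step_position_def upt by (simp add: nth_append)
qed

text \<open>The vertices with at most \<open>r\<close> up-steps before them are the ones up to the start of the
  \<open>Suc r\<close>-th up-step, so their number determines the number of down-steps before it.\<close>
lemma up_step_height_eq:
  assumes "p \<in> dyck_paths n" "r < n"
  shows "up_step_height p (Suc r)
    = 2 * int (Suc r) - int (card {k. k \<le> length p \<and> ups (take k p) < Suc r})"
proof -
  obtain a b where p: "p = a @ Up # b" "ups a = r"
    using assms split_at_up[of r p] by (auto simp: mem_dyck_paths_iff)
  have "{k. k \<le> length p \<and> ups (take k p) < Suc r} = {..length a}"
  proof (intro equalityI subsetI)
    fix k assume k: "k \<in> {..length a}"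
    have "ups a = ups (take k a) + ups (drop k a)"
      by (simp flip: count_list_append)
    then show "k \<in> {k. k \<le> length p \<and> ups (take k p) < Suc r}"
      using k p by simp
  next
    fix k assume k: "k \<in> {k. k \<le> length p \<and> ups (take k p) < Suc r}"
    show "k \<in> {..length a}"
    proof (rule ccontr)
      assume "k \<notin> {..length a}"
      then obtain i where "k = Suc (length a + i)" by (auto simp: not_le less_iff_Suc_add)
      then have "take k p = a @ Up # take i b" by (simp add: p)
      then have "ups (take k p) = Suc (r + ups (take i b))" using p by simp
      then show False using k by simp
    qed
  qed
  moreover have "up_step_height p (Suc r) = end_height a + 1"
    using up_step_position_append[of a b]
    by (simp add: up_step_height_def step_height_def snd_point_at p)
  ultimately show ?thesis using end_height_eq[of a] p by simp
qed

text \<open>Both sides count the vertices, over all paths, with fewer than \<open>r\<close> up-steps before them.\<close>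
lemma sum_card_marked:
  "(\<Sum>i<r. card (marked_dyck_paths n i))
    = (\<Sum>p\<in>dyck_paths n. card {k. k \<le> length p \<and> ups (take k p) < r})"
proof -
  have "bij_betw (\<lambda>(p, k). (take k p, drop k p))
    (SIGMA p : dyck_paths n. {k. k \<le> length p \<and> ups (take k p) < r})
    (\<Union>i<r. marked_dyck_paths n i)"
    by (rule bij_betw_byWitness[where f' = "\<lambda>(a, b). (a @ b, length a)"])
       (auto simp: marked_dyck_paths_def)
  then have "card (SIGMA p : dyck_paths n. {k. k \<le> length p \<and> ups (take k p) < r})
    = card (\<Union>i<r. marked_dyck_paths n i)"
    by (rule bij_betw_same_card)
  moreover have "card (SIGMA p : dyck_paths n. {k. k \<le> length p \<and> ups (take k p) < r})
    = (\<Sum>p\<in>dyck_paths n. card {k. k \<le> length p \<and> ups (take k p) < r})"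
    by (rule card_SigmaI) auto
  moreover have "card (\<Union>i<r. marked_dyck_paths n i) = (\<Sum>i<r. card (marked_dyck_paths n i))"
    by (rule card_UN_disjoint) (simp_all, auto simp: marked_dyck_paths_def)
  ultimately show ?thesis by simp
qed

section \<open>Partial convolutions of Catalan numbers\<close>

lemma central_binomial_Suc:
  "real ((2 * Suc n) choose Suc n) = 2 * (2 * real n + 1) / (real n + 1) * real ((2 * n) choose n)"
proof -
  have fact: "real ((2 * m) choose m) = fact (2 * m) / (fact m * fact m)" for m
    using binomial_fact[of m "2 * m", where 'a = real] by simp
  show ?thesis
    unfolding fact by (simp add: divide_simps) (simp add: algebra_simps)
qed

text \<open>Real-valued because the identities below divide.\<close>
definition catalan :: "nat \<Rightarrow> real" where
  "catalan n = real ((2 * n) choose n) / (real n + 1)"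

text \<open>The right-hand side is an antidifference: it has the value \<open>catalan t\<close> at \<open>s = 0\<close>, and
  when \<open>s\<close> grows by one with \<open>s + t\<close> constant its first summand stays the same and the second one
  grows by \<open>catalan (Suc s) * catalan (t - 1)\<close>.  Writing the total as
  \<open>s + t\<close> keeps truncated subtraction out of the right-hand side.\<close>
lemma catalan_partial_convolution:
  "(\<Sum>k\<le>s. catalan k * catalan (s + t - k)) =
     (2 * real (s + t) + 1) / (real (s + t) + 2) * catalan (s + t)
     + (real s + 1 - real t) * (2 * real s + 1) * real ((2 * s) choose s) * real ((2 * t) choose t)
       / ((real s + 1) * (real (s + t) + 1) * (real (s + t) + 2))"
proof (induction s arbitrary: t)
  case 0
  define y c where "y = real t" "c = real ((2 * t) choose t)"
  have "(2 * y + 1) * c / ((y + 2) * (y + 1)) + (1 - y) * c / ((y + 1) * (y + 2)) = c / (y + 1)"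
    by (simp add: y_c_def divide_simps) (simp add: algebra_simps)
  then show ?case
    by (simp add: catalan_def flip: y_c_def)
next
  case (Suc s)
  define b c where "b = real ((2 * s) choose s)" "c = real ((2 * t) choose t)"
  define x y where "x = real s" "y = real t"
  have nz: "x + 1 \<noteq> 0" "y + 1 \<noteq> 0" "x + 2 \<noteq> 0" "x + y + 2 \<noteq> 0" "x + y + 3 \<noteq> 0" by (simp_all add: x_y_def)
  have factor: "D * X * b * (2 * Y / q * c) / (p * u * v) + (2 * X / p * b) / w * (c / q)
      = 2 * X * b * c / p * (D * Y / (q * u * v) + 1 / (w * q))"
    for D X Y b c p q u v w :: real
    by (simp add: distrib_left mult_ac)
  have "(\<Sum>k\<le>Suc s. catalan k * catalan (Suc s + t - k))
      = (\<Sum>k\<le>s. catalan k * catalan (s + Suc t - k)) + catalan (Suc s) * catalan t"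
    by simp
  also have "\<dots> = (2 * real (s + Suc t) + 1) / (real (s + Suc t) + 2) * catalan (s + Suc t)
     + ((x - y) * (2 * x + 1) * b * (2 * (2 * y + 1) / (y + 1) * c)
       / ((x + 1) * (x + y + 2) * (x + y + 3))
     + (2 * (2 * x + 1) / (x + 1) * b) / (x + 2) * (c / (y + 1)))"
  proof -
    have "real (s + Suc t) + 1 = x + y + 2" "real (s + Suc t) + 2 = x + y + 3" "real s + 1 - real (Suc t) = x - y"
      by (simp_all add: x_y_def)
    moreover have "catalan (Suc s) = (2 * (2 * x + 1) / (x + 1) * b) / (x + 2)"
      unfolding catalan_def central_binomial_Suc by (simp add: x_y_def b_c_def add_ac)
    ultimately show ?thesis
      unfolding Suc.IH central_binomial_Suc[of t] catalan_def[of t] x_y_def[symmetric] b_c_def[symmetric]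
      by (simp add: add_ac)
  qed
  also have "(x - y) * (2 * x + 1) * b * (2 * (2 * y + 1) / (y + 1) * c)
       / ((x + 1) * (x + y + 2) * (x + y + 3))
     + (2 * (2 * x + 1) / (x + 1) * b) / (x + 2) * (c / (y + 1))
    = 2 * (2 * x + 1) * b * c / (x + 1) *
      ((x - y) * (2 * y + 1) / ((y + 1) * (x + y + 2) * (x + y + 3)) + 1 / ((x + 2) * (y + 1)))"
    by (rule factor)
  also have "(x - y) * (2 * y + 1) / ((y + 1) * (x + y + 2) * (x + y + 3)) + 1 / ((x + 2) * (y + 1))
     = (x + 2 - y) * (2 * x + 3) / ((x + 2) * (x + y + 2) * (x + y + 3))"
    using nz by (simp add: divide_simps) (simp add: algebra_simps)
  also have "2 * (2 * x + 1) * b * c / (x + 1) * ((x + 2 - y) * (2 * x + 3) / ((x + 2) * (x + y + 2) * (x + y + 3)))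
    = (x + 2 - y) * (2 * x + 3) * (2 * (2 * x + 1) / (x + 1) * b) * c
       / ((x + 2) * (x + y + 2) * (x + y + 3))"
    by simp
  finally show ?case
    unfolding central_binomial_Suc[of s] x_y_def b_c_def by (simp add: add_ac)
qed

lemma catalan_Suc: "catalan (Suc n) = (4 * real n + 2) / (real n + 2) * catalan n"
  unfolding catalan_def central_binomial_Suc by (simp add: divide_simps)

text \<open>For \<open>t = 0\<close> the two summands of the closed form coincide.\<close>
lemma catalan_convolution: "(\<Sum>k\<le>n. catalan k * catalan (n - k)) = catalan (Suc n)"
proof -
  have "real ((2 * n) choose n) = (real n + 1) * catalan n" by (simp add: catalan_def)
  then show ?thesis
    using catalan_partial_convolution[of n 0] unfolding catalan_Suc
    by (simp add: divide_simps)
qed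

section \<open>Counting Dyck paths and marked Dyck paths\<close>

lemma card_dyck_paths_0: "card (dyck_paths 0) = 1"
proof -
  have "p = []" if "p \<in> dyck_paths 0" for p
    using that end_height_eq[of p] by (auto simp: mem_dyck_paths_iff)
  moreover have "[] \<in> dyck_paths 0" by (simp add: mem_dyck_paths_iff)
  ultimately have "dyck_paths 0 = {[]}" by blast
  then show ?thesis by simp
qed

text \<open>The last step of a nonempty Dyck path is a down-step; its matching up-step splits the
  path into the part \<open>a\<close> before it and the part \<open>B\<close> enclosed by the pair.\<close>
lemma card_dyck_paths_Suc:
  "card (dyck_paths (Suc n)) = (\<Sum>j\<le>n. card (dyck_paths j) * card (dyck_paths (n - j)))"
proof -
  let ?A = "SIGMA j : {..n}. dyck_paths j \<times> dyck_paths (n - j)"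
  let ?f = "\<lambda>(j, B, a). a @ Up # B @ [Down]"
  have "bij_betw ?f ?A (dyck_paths (Suc n))"
  proof (rule bij_betw_imageI)
    show "inj_on ?f ?A"
    proof (rule inj_onI)
      fix x x' assume "x \<in> ?A" "x' \<in> ?A" and eq: "?f x = ?f x'"
      then obtain j B a j' B' a' where x: "x = (j, B, a)" "x' = (j', B', a')"
          "B \<in> dyck_paths j" "B' \<in> dyck_paths j'"
        by auto
      with eq have "a = a' \<and> B = B'"
        using last_up_below_unique[of a B a' B'] by (auto simp: mem_dyck_paths_iff)
      with x show "x = x'" by (auto simp: mem_dyck_paths_iff)
    qed
    show "?f ` ?A = dyck_paths (Suc n)"
    proof (intro equalityI subsetI)
      fix y assume "y \<in> ?f ` ?A"
      then obtain j B a where "y = a @ Up # B @ [Down]" "j \<le> n" "B \<in> dyck_paths j" "a \<in> dyck_paths (n - j)"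
        by auto
      then show "y \<in> dyck_paths (Suc n)" using insert_dyck_path[of B j a "[]" "Suc n"] by simp
    next
      fix y assume y: "y \<in> dyck_paths (Suc n)"
      then have "y \<noteq> []" by (auto simp: mem_dyck_paths_iff)
      then obtain q x where q: "y = q @ [x]" by (metis rev_exhaust)
      have "x = Down"
        using y stays_nonneg_end[of 0 q] by (cases x) (auto simp: mem_dyck_paths_iff q)
      then have q: "y = q @ [Down]" "stays_nonneg 0 q" "1 \<le> end_height q"
        using y by (auto simp: mem_dyck_paths_iff q)
      then obtain a B where aB: "q = a @ Up # B" "stays_nonneg 0 B" "end_height B = 0"
        using last_up_below by blast
      then have B: "B \<in> dyck_paths (ups B)" by (simp add: mem_dyck_paths_iff)
      show "y \<in> ?f ` ?A"
        using y insert_dyck_path[OF B, of a "[]" "Suc n"] B q aB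
        by (intro image_eqI[of _ _ "(ups B, B, a)"]) auto
    qed
  qed
  then have "card ?A = card (dyck_paths (Suc n))" by (rule bij_betw_same_card)
  then show ?thesis by (simp add: card_cartesian_product)
qed

lemma card_dyck_paths: "real (card (dyck_paths n)) = catalan n"
proof (induction n rule: less_induct)
  case (less n)
  show ?case
  proof (cases n)
    case 0 then show ?thesis by (simp add: card_dyck_paths_0 catalan_def)
  next
    case (Suc m)
    have "real (card (dyck_paths n)) = (\<Sum>j\<le>m. catalan j * catalan (m - j))"
      unfolding Suc card_dyck_paths_Suc of_nat_sum of_nat_mult
      by (rule sum.cong) (auto simp: less.IH Suc)
    then show ?thesis by (simp add: catalan_convolution Suc)
  qed
qed

text \<open>After one use of \<open>card_marked_rec\<close> the double sum is grouped by the diagonals \<open>j + k = m\<close>;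
  the sum along a diagonal is a complete Catalan convolution.\<close>
lemma card_marked_dyck_paths:
  "r \<le> n \<Longrightarrow> real (card (marked_dyck_paths n r)) = (\<Sum>k\<le>r. catalan k * catalan (n - k))"
proof (induction n arbitrary: r rule: less_induct)
  case (less n)
  have "real (card (marked_dyck_paths n r)) = catalan n
    + (\<Sum>j<r. catalan j * real (card (marked_dyck_paths (n - Suc j) (r - Suc j))))"
    using card_marked_rec[OF less.prems] by (simp add: card_dyck_paths)
  also have "(\<Sum>j<r. catalan j * real (card (marked_dyck_paths (n - Suc j) (r - Suc j))))
     = (\<Sum>j<r. \<Sum>k\<le>r - Suc j. catalan j * catalan k * catalan (n - Suc (j + k)))"
    using less.prems by (intro sum.cong) (auto simp: less.IH sum_distrib_left mult_ac)
  also have "\<dots> = (\<Sum>(j, k)\<in>{(j, k). j + k < r}. catalan j * catalan k * catalan (n - Suc (j + k)))"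
    by (subst sum.Sigma) (auto intro!: sum.cong)
  also have "\<dots> = (\<Sum>m<r. \<Sum>j\<le>m. catalan j * catalan (m - j) * catalan (n - Suc m))"
    by (subst sum.triangle_reindex) (auto intro!: sum.cong)
  also have "\<dots> = (\<Sum>m<r. catalan (Suc m) * catalan (n - Suc m))"
    by (simp add: catalan_convolution flip: sum_distrib_right)
  finally show ?case by (simp add: sum.atMost_shift catalan_def[of 0])
qed

section \<open>The average height\<close>

definition average_formula :: "nat \<Rightarrow> nat \<Rightarrow> real" where
  "average_formula n r = (2 * real r + 1) * (2 * (real n - real r) + 1) / (real n + 2)
          * (real ((2 * r) choose r) * real ((2 * (n - r)) choose (n - r)) / real ((2 * n) choose n))
          + 3 * (real r + 1) / (real n + 2) - 2"

text \<open>Induction on \<open>r\<close>, starting from \<open>average_formula n 0 = 0\<close>.  With \<open>x = r\<close> and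
  \<open>y = n - r - 1\<close>, the product of central binomials contributes a common factor \<open>d\<close> to
  all three terms of the step, and what is left after cancelling it is an identity between rational
  functions of \<open>x\<close> and \<open>y\<close>.\<close>
lemma catalan_double_sum:
  assumes "r \<le> n"
  shows "2 * real r * catalan n - (\<Sum>i<r. \<Sum>k\<le>i. catalan k * catalan (n - k))
   = average_formula n r * catalan n"
  using assms
proof (induction r)
  case 0
  then show ?case by (simp add: average_formula_def divide_simps)
next
  case (Suc r)
  obtain t where n: "n = Suc (r + t)" using Suc.prems by (auto simp: Suc_le_eq less_iff_Suc_add)
  define a b c where "a = real ((2 * r) choose r)" "b = real ((2 * t) choose t)" "c = real ((2 * n) choose n)"
  define x y where "x = real r" "y = real t"
  define d where "d = 2 * (2 * x + 1) * (2 * y + 1) * a * b / ((x + y + 2) * (x + y + 3))"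
  have nz: "x + 1 \<noteq> 0" "y + 1 \<noteq> 0" "x + y + 2 \<noteq> 0" "x + y + 3 \<noteq> 0" "c \<noteq> 0"
    by (simp_all add: x_y_def a_b_c_def)
  have xy: "real n + 1 = x + y + 2" "real n + 2 = x + y + 3" "real n = x + y + 1"
    "real (Suc r) = x + 1" "real (Suc t) = y + 1" "n - r = Suc t" "n - Suc r = t" "r + Suc t = n"
    by (simp_all add: n x_y_def)
  have cat: "catalan n = c / (x + y + 2)"
    by (simp add: catalan_def xy a_b_c_def)
  have 1: "average_formula n r * catalan n = d * ((2 * y + 3) / (y + 1)) + (3 * (x + 1) / (x + y + 3) - 2) * catalan n"
  proof -
    have "average_formula n r = (2 * x + 1) * (2 * y + 3) / (x + y + 3) * (a * (2 * (2 * y + 1) / (y + 1) * b) / c)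
       + (3 * (x + 1) / (x + y + 3) - 2)"
      unfolding average_formula_def xy central_binomial_Suc unfolding a_b_c_def[symmetric] x_y_def[symmetric] xy
      by (simp add: add_ac)
    moreover have "(2 * x + 1) * (2 * y + 3) / (x + y + 3) * (a * (2 * (2 * y + 1) / (y + 1) * b) / c)
        * (c / (x + y + 2)) = d * ((2 * y + 3) / (y + 1))"
    proof -
      have "X * P / p * (a * (2 * Y / q * b) / c) * (c / m) = 2 * X * Y * a * b / (m * p) * (P / q)"
        for X P p q m Y :: real using nz by (simp add: mult_ac)
      then show ?thesis unfolding d_def .
    qed
    ultimately show ?thesis unfolding cat by (simp only: distrib_right)
  qed
  have 2: "average_formula n (Suc r) * catalan n = d * ((2 * x + 3) / (x + 1)) + (3 * (x + 2) / (x + y + 3) - 2) * catalan n"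
  proof -
    have "average_formula n (Suc r) = (2 * x + 3) * (2 * y + 1) / (x + y + 3) * ((2 * (2 * x + 1) / (x + 1) * a) * b / c)
       + (3 * (x + 2) / (x + y + 3) - 2)"
      unfolding average_formula_def xy central_binomial_Suc unfolding a_b_c_def[symmetric] x_y_def[symmetric] xy
      by (simp add: add_ac)
    moreover have "(2 * x + 3) * (2 * y + 1) / (x + y + 3) * ((2 * (2 * x + 1) / (x + 1) * a) * b / c)
        * (c / (x + y + 2)) = d * ((2 * x + 3) / (x + 1))"
    proof -
      have "P * Y / p * ((2 * X / q * a) * b / c) * (c / m) = 2 * X * Y * a * b / (m * p) * (P / q)"
        for X P p q m Y :: real using nz by (simp add: mult_ac)
      then show ?thesis unfolding d_def .
    qed
    ultimately show ?thesis unfolding cat by (simp only: distrib_right)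
  qed
  have 3: "(\<Sum>k\<le>r. catalan k * catalan (n - k))
     = (2 * (x + y) + 3) / (x + y + 3) * catalan n + d * ((x - y) / ((x + 1) * (y + 1)))"
  proof -
    have "(\<Sum>k\<le>r. catalan k * catalan (n - k)) = (2 * (x + y) + 3) / (x + y + 3) * catalan n +
      (x - y) * (2 * x + 1) * a * (2 * (2 * y + 1) / (y + 1) * b) / ((x + 1) * (x + y + 2) * (x + y + 3))"
      using catalan_partial_convolution[of r "Suc t"]
      unfolding xy central_binomial_Suc unfolding a_b_c_def[symmetric] x_y_def[symmetric]
      by (simp add: add_ac)
    also have "(x - y) * (2 * x + 1) * a * (2 * (2 * y + 1) / (y + 1) * b) / ((x + 1) * (x + y + 2) * (x + y + 3))
      = d * ((x - y) / ((x + 1) * (y + 1)))"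
    proof -
      have "D * X * a * (2 * Y / q * b) / (w * m * p) = 2 * X * Y * a * b / (m * p) * (D / (w * q))"
        for D X Y p q m w :: real by (simp add: mult_ac)
      then show ?thesis unfolding d_def .
    qed
    finally show ?thesis .
  qed
  have "(2 * y + 3) / (y + 1) = (2 * x + 3) / (x + 1) + (x - y) / ((x + 1) * (y + 1))"
    using nz by (simp add: divide_simps) (simp add: algebra_simps)
  moreover have "3 * (x + 2) / (x + y + 3) - 2 = 3 * (x + 1) / (x + y + 3) - 2 + 2 - (2 * (x + y) + 3) / (x + y + 3)"
    using nz by (simp add: divide_simps)
  moreover have "d * q + A' * z = (d * p + A * z) + 2 * z - (S * z + d * w)"
    if "p = q + w" "A' = A + 2 - S" for p q w A A' S z :: real
    unfolding that by (simp add: algebra_simps)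
  ultimately have "average_formula n (Suc r) * catalan n
      = average_formula n r * catalan n + 2 * catalan n - (\<Sum>k\<le>r. catalan k * catalan (n - k))"
    unfolding 1 2 3 by blast
  then show ?case using Suc by (simp add: algebra_simps)
qed

lemma average_up_step_height_eq:
  assumes "1 \<le> r" "r \<le> n"
  shows "average_up_step_height n r = average_formula n r"
proof -
  have pos: "catalan n > 0" by (simp add: catalan_def)
  then have ne: "dyck_paths n \<noteq> {}" using card_dyck_paths[of n] by auto
  have "(\<Sum>p\<in>dyck_paths n. real_of_int (up_step_height p r))
      = (\<Sum>p\<in>dyck_paths n. 2 * real r - real (card {k. k \<le> length p \<and> ups (take k p) < r}))"
    using assms up_step_height_eq[of _ n "r - 1"] by (intro sum.cong) auto
  also have "\<dots> = 2 * real r * catalan n - real (\<Sum>i<r. card (marked_dyck_paths n i))"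
    unfolding sum_card_marked by (simp add: sum_subtractf card_dyck_paths)
  also have "\<dots> = 2 * real r * catalan n - (\<Sum>i<r. \<Sum>k\<le>i. catalan k * catalan (n - k))"
    using assms by (simp add: card_marked_dyck_paths)
  also have "\<dots> = average_formula n r * catalan n" by (rule catalan_double_sum) fact
  finally show ?thesis
    using ne pos by (simp add: average_up_step_height_def integral_pmf_of_set card_dyck_paths)
qed

section \<open>Asymptotics\<close>

text \<open>The probability that \<open>2 * n\<close> fair coin tosses give equally many heads and tails.\<close>
definition central_weight :: "nat \<Rightarrow> real" where
  "central_weight n = real ((2 * n) choose n) / 4 ^ n"

lemma central_weight_pos: "central_weight n > 0"
  by (simp add: central_weight_def)

lemma central_weight_Suc: "central_weight (Suc n) = (2 * real n + 1) / (2 * (real n + 1)) * central_weight n"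
  unfolding central_weight_def central_binomial_Suc by (simp add: divide_simps) (simp add: algebra_simps)

lemma central_weight_gbinomial: "central_weight n = (- 1) ^ n * ((- 1 / 2) gchoose n)"
proof (induction n)
  case 0 then show ?case by (simp add: central_weight_def)
next
  case (Suc n)
  have "(-1/2 :: real) gchoose Suc n = (- 1 / 2 - real n) / (real n + 1) * ((-1/2) gchoose n)"
    using gbinomial_mult_1[of "-1/2 :: real" n] by (simp add: field_simps)
  then show ?case by (simp add: central_weight_Suc Suc) (simp add: field_simps)
qed

text \<open>By \<open>central_weight_gbinomial\<close> this is the asymptotics of generalized binomial coefficients
  with upper argument \<open>-1/2\<close>; the constant is \<open>1 / Gamma (1/2)\<close>.\<close>
lemma central_weight_asymp_equiv:
  "central_weight \<sim>[sequentially] (\<lambda>n. 1 / sqrt (pi * real n))"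
proof (rule asymp_equivI')
  have "((\<lambda>n. ((-1/2 :: real) gchoose n) / ((-1) ^ n / exp ((-1/2 + 1) * of_real (ln (real n)))))
     \<longlonglongrightarrow> inverse (Gamma (- (-1/2))))"
    by (rule gbinomial_asymptotic)
  then have "((\<lambda>n. sqrt pi * (((-1/2 :: real) gchoose n) / ((-1) ^ n / exp ((-1/2 + 1) * of_real (ln (real n))))))
     \<longlonglongrightarrow> sqrt pi * (inverse (Gamma (- (-1/2)))))"
    by (rule tendsto_mult_left)
  also have "sqrt pi * (inverse (Gamma (- (-1/2)))) = 1"
    using Gamma_one_half_real by simp
  finally have lim: "((\<lambda>n. sqrt pi * (((-1/2 :: real) gchoose n) / ((-1) ^ n / exp ((-1/2 + 1) * of_real (ln (real n))))))
     \<longlonglongrightarrow> 1)" .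
  show "(\<lambda>n. central_weight n / (1 / sqrt (pi * real n))) \<longlonglongrightarrow> 1"
  proof (rule Lim_transform_eventually[OF lim])
    show "\<forall>\<^sub>F n in sequentially. sqrt pi * (((-1/2 :: real) gchoose n) / ((-1) ^ n / exp ((-1/2 + 1) * of_real (ln (real n)))))
       = central_weight n / (1 / sqrt (pi * real n))"
      using eventually_gt_at_top[of 0]
    proof eventually_elim
      case (elim n)
      have "exp ((-1/2 + 1) * of_real (ln (real n))) = sqrt (real n)"
        using elim powr_half_sqrt[of "real n"] by (simp add: powr_def)
      then show ?case
        by (cases "even n") (simp_all add: central_weight_gbinomial real_sqrt_mult)
    qed
  qed
qed

lemma average_formula_central_weight:
  assumes "r \<le> n"
  shows "average_formula n r = (2 * real r + 1) * (2 * real (n - r) + 1) / (real n + 2)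
     * (central_weight r * central_weight (n - r) / central_weight n) + 3 * (real r + 1) / (real n + 2) - 2"
proof -
  have "(4::real) ^ n = 4 ^ r * 4 ^ (n - r)" using assms by (simp flip: power_add)
  then show ?thesis using assms
    by (simp add: average_formula_def central_weight_def of_nat_diff)
qed

lemma central_weight_ratio: "(\<lambda>n. central_weight (n - s) / central_weight n) \<longlonglongrightarrow> 1"
proof (rule asymp_equivD_strong)
  have "(\<lambda>n. central_weight (n - s)) \<sim>[sequentially] (\<lambda>n. 1 / sqrt (pi * real (n - s)))"
    using asymp_equiv_compose'[OF central_weight_asymp_equiv, of "\<lambda>n. n - s"]
    by (simp add: filterlim_minus_const_nat_at_top)
  also have "(\<lambda>n. 1 / sqrt (pi * real (n - s))) \<sim>[sequentially] (\<lambda>n. 1 / sqrt (pi * real n))"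
  proof -
    have "(\<lambda>n. 1 / sqrt (pi * (real n - real s))) \<sim>[sequentially] (\<lambda>n. 1 / sqrt (pi * real n))"
      by real_asymp
    moreover have "\<forall>\<^sub>F n in sequentially. 1 / sqrt (pi * (real n - real s)) = 1 / sqrt (pi * real (n - s))"
      using eventually_ge_at_top[of s] by eventually_elim (simp add: of_nat_diff)
    ultimately show ?thesis
      by (subst (asm) asymp_equiv_cong[OF _ always_eventually]) auto
  qed
  also have "\<dots> \<sim>[sequentially] central_weight"
    by (rule asymp_equiv_symI, rule central_weight_asymp_equiv)
  finally show "(\<lambda>n. central_weight (n - s)) \<sim>[sequentially] central_weight" .
qed (use central_weight_pos less_imp_neq[symmetric] in \<open>auto intro!: always_eventually\<close>)

lemma average_formula_fixed_r: "(\<lambda>n. average_formula n r) \<longlonglongrightarrow> (4 * real r + 2) / 4 ^ r * real ((2 * r) choose r) - 2"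
proof -
  have "(\<lambda>n. (2 * real r + 1) * central_weight r * ((2 * (real n - real r) + 1) / (real n + 2))
     * (central_weight (n - r) / central_weight n) + (3 * (real r + 1) / (real n + 2) - 2))
     \<longlonglongrightarrow> (2 * real r + 1) * central_weight r * 2 * 1 + (0 - 2)"
    by (intro tendsto_intros central_weight_ratio; real_asymp)
  then have "(\<lambda>n. average_formula n r) \<longlonglongrightarrow> (2 * real r + 1) * central_weight r * 2 * 1 + (0 - 2)"
    by (rule Lim_transform_eventually)
       (use eventually_ge_at_top[of r] in eventually_elim, simp add: average_formula_central_weight of_nat_diff)
  then show ?thesis by (simp add: central_weight_def algebra_simps add_divide_distrib)
qed

lemma average_formula_fixed_s: "(\<lambda>n. average_formula n (n - s)) \<longlonglongrightarrow> (4 * real s + 2) / 4 ^ s * real ((2 * s) choose s) + 1"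
proof -
  have "(\<lambda>n. (2 * real s + 1) * central_weight s * ((2 * (real n - real s) + 1) / (real n + 2))
     * (central_weight (n - s) / central_weight n) + (3 * (real n - real s + 1) / (real n + 2) - 2))
     \<longlonglongrightarrow> (2 * real s + 1) * central_weight s * 2 * 1 + (3 - 2)"
    by (intro tendsto_intros central_weight_ratio; real_asymp)
  then have "(\<lambda>n. average_formula n (n - s)) \<longlonglongrightarrow> (2 * real s + 1) * central_weight s * 2 * 1 + (3 - 2)"
    by (rule Lim_transform_eventually)
       (use eventually_ge_at_top[of s] in eventually_elim, simp add: average_formula_central_weight of_nat_diff mult_ac)
  then show ?thesis by (simp add: central_weight_def algebra_simps add_divide_distrib)
qed

text \<open>Replacing each factor of the main part \<open>M\<close> by its equivalent gives the target \<open>g\<close>.  The rest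
  of the average is bounded and therefore negligible: \<open>g\<close> tends to infinity, because
  \<open>r * (n - r) / n\<close> is the inverse of \<open>1 / r + 1 / (n - r)\<close>.\<close>
lemma average_formula_both_large:
  fixes r :: "nat \<Rightarrow> nat"
  assumes r: "filterlim r at_top sequentially" and s: "filterlim (\<lambda>n. n - r n) at_top sequentially"
  shows "(\<lambda>n. average_formula n (r n)) \<sim>[sequentially]
          (\<lambda>n. 4 / sqrt pi * sqrt (real (r n) * (1 - real (r n) / real n)))"
proof -
  define g where "g = (\<lambda>n. 4 / sqrt pi * sqrt (real (r n) * (1 - real (r n) / real n)))"
  have pos: "\<forall>\<^sub>F n in sequentially. 0 < r n \<and> r n < n"
    using filterlim_at_top[THEN iffD1, OF r, rule_format, of 1]
      filterlim_at_top[THEN iffD1, OF s, rule_format, of 1]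
    by eventually_elim auto
  define M where "M = (\<lambda>n. (2 * real (r n) + 1) * (2 * real (n - r n) + 1) / (real n + 2)
     * (central_weight (r n) * central_weight (n - r n) / central_weight n))"
  have lin: "(\<lambda>m::nat. 2 * real m + 1) \<sim>[sequentially] (\<lambda>m. 2 * real m)" by real_asymp
  have lin2: "(\<lambda>m::nat. real m + 2) \<sim>[sequentially] (\<lambda>m. real m)" by real_asymp
  have "M \<sim>[sequentially] (\<lambda>n. 2 * real (r n) * (2 * real (n - r n)) / real n
     * (1 / sqrt (pi * real (r n)) * (1 / sqrt (pi * real (n - r n))) / (1 / sqrt (pi * real n))))"
    unfolding M_def
    by (intro asymp_equiv_mult asymp_equiv_divide lin2 central_weight_asymp_equiv
        asymp_equiv_compose'[OF lin r] asymp_equiv_compose'[OF lin s]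
        asymp_equiv_compose'[OF central_weight_asymp_equiv r]
        asymp_equiv_compose'[OF central_weight_asymp_equiv s])
  also have "\<dots> \<sim>[sequentially] g"
  proof (rule asymp_equiv_refl_ev)
    show "\<forall>\<^sub>F n in sequentially. 2 * real (r n) * (2 * real (n - r n)) / real n
     * (1 / sqrt (pi * real (r n)) * (1 / sqrt (pi * real (n - r n))) / (1 / sqrt (pi * real n))) = g n"
      using pos
    proof eventually_elim
      case (elim n)
      define x y where "x = sqrt (real (r n))" "y = sqrt (real (n - r n))"
      define z where "z = sqrt (real n)"
      have sq: "x > 0" "y > 0" "z > 0" "real (r n) = x * x" "real (n - r n) = y * y" "real n = z * z"
        using elim by (auto simp: x_y_def z_def)
      have "real (r n) * (1 - real (r n) / real n) = real (r n) * real (n - r n) / real n"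
        using elim by (simp add: of_nat_diff field_simps)
      then have "g n = 4 / sqrt pi * (x * y / z)"
        unfolding g_def x_y_def z_def by (simp only: real_sqrt_mult real_sqrt_divide)
      moreover have "2 * real (r n) * (2 * real (n - r n)) / real n
        * (1 / sqrt (pi * real (r n)) * (1 / sqrt (pi * real (n - r n))) / (1 / sqrt (pi * real n)))
        = 2 * (x * x) * (2 * (y * y)) / (z * z) * (1 / (sqrt pi * x) * (1 / (sqrt pi * y)) / (1 / (sqrt pi * z)))"
        unfolding real_sqrt_mult sq(4-) using sq(1-3) by simp
      moreover have "\<dots> = 4 / sqrt pi * (x * y / z)"
        using sq by (simp add: divide_simps)
      ultimately show ?case by simp
    qed
  qed
  finally have Mg: "M \<sim>[sequentially] g" .
  have g_lim: "filterlim g at_top sequentially"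
  proof -
    have "filterlim (\<lambda>n. inverse (inverse (real (r n)) + inverse (real (n - r n)))) at_top sequentially"
    proof (rule filterlim_inverse_at_top)
      have "(\<lambda>n. inverse (real (r n)) + inverse (real (n - r n))) \<longlonglongrightarrow> 0 + 0"
        by (intro tendsto_add tendsto_inverse_0_at_top filterlim_compose[OF filterlim_real_sequentially r]
            filterlim_compose[OF filterlim_real_sequentially s])
      then show "(\<lambda>n. inverse (real (r n)) + inverse (real (n - r n))) \<longlonglongrightarrow> 0" by simp
      show "\<forall>\<^sub>F n in sequentially. 0 < inverse (real (r n)) + inverse (real (n - r n))"
        using pos by eventually_elim (simp add: add_pos_pos)
    qed
    then have "filterlim (\<lambda>n. sqrt (inverse (inverse (real (r n)) + inverse (real (n - r n))))) at_top sequentially"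
      by (rule filterlim_compose[OF sqrt_at_top])
    then have "filterlim (\<lambda>n. 4 / sqrt pi * sqrt (inverse (inverse (real (r n)) + inverse (real (n - r n))))) at_top sequentially"
      by (rule filterlim_tendsto_pos_mult_at_top[OF tendsto_const, rotated]) simp
    then show ?thesis
    proof (rule filterlim_mono_eventually)
      show "\<forall>\<^sub>F n in sequentially. 4 / sqrt pi * sqrt (inverse (inverse (real (r n)) + inverse (real (n - r n)))) = g n"
        using pos
      proof eventually_elim
        case (elim n)
        then have "inverse (inverse (real (r n)) + inverse (real (n - r n))) = real (r n) * (1 - real (r n) / real n)"
          by (simp add: of_nat_diff field_simps)
        then show ?case by (simp add: g_def)
      qed
    qed simp_all
  qed
  have "(\<lambda>n. 3 * (real (r n) + 1) / (real n + 2) - 2) \<in> o(g)"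
  proof -
    have "(\<lambda>n. 3 * (real (r n) + 1) / (real n + 2) - 2) \<in> O(\<lambda>_. 1)"
    proof (rule bigoI[of _ 5])
      show "\<forall>\<^sub>F n in sequentially. norm (3 * (real (r n) + 1) / (real n + 2) - 2) \<le> 5 * norm (1::real)"
        using pos
      proof eventually_elim
        case (elim n)
        then have "0 \<le> 3 * (real (r n) + 1) / (real n + 2)" "3 * (real (r n) + 1) / (real n + 2) \<le> 3"
          by (auto simp: field_simps)
        then show ?case unfolding real_norm_def abs_one by linarith
      qed
    qed
    also have "(\<lambda>_. 1) \<in> o(g)"
      using g_lim by (simp add: smallomega_iff_smallo[symmetric] smallomega_1_conv_filterlim
          filterlim_at_top_imp_at_infinity)
    finally show ?thesis .
  qed
  with Mg have "(\<lambda>n. M n + (3 * (real (r n) + 1) / (real n + 2) - 2)) \<sim>[sequentially] g"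
    using asymp_equiv_add_right by blast
  moreover have "\<forall>\<^sub>F n in sequentially. M n + (3 * (real (r n) + 1) / (real n + 2) - 2) = average_formula n (r n)"
    using pos by eventually_elim (simp add: average_formula_central_weight M_def)
  ultimately have "(\<lambda>n. average_formula n (r n)) \<sim>[sequentially] g"
    by (subst (asm) asymp_equiv_cong[OF _ always_eventually]) auto
  then show ?thesis by (simp add: g_def)
qed

theorem theorem3p5:
  shows
    "(\<forall>n r. 1 \<le> r \<and> r \<le> n \<longrightarrow>
        average_up_step_height n r =
          (2 * real r + 1) * (2 * (real n - real r) + 1) / (real n + 2)
          * (real ((2 * r) choose r) * real ((2 * (n - r)) choose (n - r)) / real ((2 * n) choose n))
          + 3 * (real r + 1) / (real n + 2) - 2)
     \<and> (\<forall>r \<ge> 1. (\<lambda>n. average_up_step_height n r)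
          \<longlonglongrightarrow> (4 * real r + 2) / 4 ^ r * real ((2 * r) choose r) - 2)
     \<and> (\<forall>s. (\<lambda>n. average_up_step_height n (n - s))
          \<longlonglongrightarrow> (4 * real s + 2) / 4 ^ s * real ((2 * s) choose s) + 1)
     \<and> (\<forall>r :: nat \<Rightarrow> nat.
          filterlim r at_top sequentially \<and> filterlim (\<lambda>n. n - r n) at_top sequentially \<longrightarrow>
          (\<lambda>n. average_up_step_height n (r n)) \<sim>[sequentially]
          (\<lambda>n. 4 / sqrt pi * sqrt (real (r n) * (1 - real (r n) / real n))))"
proof (intro conjI allI impI)
  fix n r :: nat
  assume "1 \<le> r \<and> r \<le> n"
  then show "average_up_step_height n r =
      (2 * real r + 1) * (2 * (real n - real r) + 1) / (real n + 2)
      * (real ((2 * r) choose r) * real ((2 * (n - r)) choose (n - r)) / real ((2 * n) choose n))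
      + 3 * (real r + 1) / (real n + 2) - 2"
    using average_up_step_height_eq[of r n] by (simp only: average_formula_def)
next
  fix r :: nat
  assume "1 \<le> r"
  then have "\<forall>\<^sub>F n in sequentially. average_formula n r = average_up_step_height n r"
    by (intro eventually_mono[OF eventually_ge_at_top[of r]]) (simp add: average_up_step_height_eq)
  then show "(\<lambda>n. average_up_step_height n r)
      \<longlonglongrightarrow> (4 * real r + 2) / 4 ^ r * real ((2 * r) choose r) - 2"
    by (rule Lim_transform_eventually[OF average_formula_fixed_r])
next
  fix s :: nat
  have "\<forall>\<^sub>F n in sequentially. average_formula n (n - s) = average_up_step_height n (n - s)"
    by (intro eventually_mono[OF eventually_gt_at_top[of s]]) (simp add: average_up_step_height_eq)
  then show "(\<lambda>n. average_up_step_height n (n - s))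
      \<longlonglongrightarrow> (4 * real s + 2) / 4 ^ s * real ((2 * s) choose s) + 1"
    by (rule Lim_transform_eventually[OF average_formula_fixed_s])
next
  fix r :: "nat \<Rightarrow> nat"
  assume r: "filterlim r at_top sequentially \<and> filterlim (\<lambda>n. n - r n) at_top sequentially"
  have "\<forall>\<^sub>F n in sequentially. 1 \<le> r n" "\<forall>\<^sub>F n in sequentially. 1 \<le> n - r n"
    using r unfolding filterlim_at_top by blast+
  then have "\<forall>\<^sub>F n in sequentially. average_up_step_height n (r n) = average_formula n (r n)"
    by eventually_elim (simp add: average_up_step_height_eq)
  then have "(\<lambda>n. average_up_step_height n (r n)) \<sim>[sequentially] (\<lambda>n. average_formula n (r n))"
    by (rule asymp_equiv_refl_ev)
  also have "\<dots> \<sim>[sequentially] (\<lambda>n. 4 / sqrt pi * sqrt (real (r n) * (1 - real (r n) / real n)))"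
    using r by (intro average_formula_both_large) auto
  finally show "(\<lambda>n. average_up_step_height n (r n)) \<sim>[sequentially]
      (\<lambda>n. 4 / sqrt pi * sqrt (real (r n) * (1 - real (r n) / real n)))" .
qed

end
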